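(* Let $\omega_1$ be the (positive) harmonic function on the open unit disk $\mathbb{D}$ defined by $\omega_1(z):=(1-|z|^2)/|1-z|^2$. Then there exists $f\in\mathcal{D}_{\omega_1}$ such that $\sigma_n^{1/2}[f]$ does not converge to $f$ in the norm of $\mathcal{D}_{\omega_1}$ as $n\to\infty$.
   Context: $\mathbb{D}$ is the open unit disk in $\mathbb{C}$ and $dA$ is normalized area measure on $\mathbb{D}$. For a positive superharmonic function $\omega$ on $\mathbb{D}$ (in particular, for a positive harmonic function) and a holomorphic function $f$ on $\mathbb{D}$, set $\mathcal{D}_\omega(f):=\int_{\mathbb{D}}|f'(z)|^2\,\omega(z)\,dA(z)$. The weighted Dirichlet space $\mathcal{D}_\omega$ is the set of holomorphic $f$ on $\mathbb{D}$ with $\mathcal{D}_\omega(f)<\infty$; with the norm $\|f\|_{\mathcal{D}_\omega}^2:=|f(0)|^2+\mathcal{D}_\omega(f)$ it is a Hilbert space containing the polynomials. For $f(z)=\sum_{k=0}^\infty a_kz^k$ and $\alpha>0$, the generalized Cesàro means are $$\sigma_n^\alpha[f](z):=\binom{n+\alpha}{\alpha}^{-1}\sum_{k=0}^n\binom{n-k+\alpha}{\alpha}a_kz^k,\qquad \binom{n+\alpha}{\alpha}:=\frac{\Gamma(n+\alpha+1)}{\Gamma(\alpha+1)\Gamma(n+1)},$$ where $\Gamma$ is the gamma function. *)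

theory Defs
  imports "HOL-Complex_Analysis.Complex_Analysis"
begin

abbreviation unit_disk :: "complex set"
  where "unit_disk \<equiv> ball 0 1"

definition disk_area :: "complex measure"
  where "disk_area = uniform_measure lborel unit_disk"

text \<open>
  Weights are assumed nonnegative on the disk; their values elsewhere are irrelevant, since
  \<open>disk_area\<close> vanishes off the disk. The integral is taken in \<open>ennreal\<close>, so that it always has
  its true value, possibly \<open>\<infinity>\<close>.
\<close>

definition dirichlet_integral :: "(complex \<Rightarrow> real) \<Rightarrow> (complex \<Rightarrow> complex) \<Rightarrow> ennreal"
  where "dirichlet_integral \<omega> f = (\<integral>\<^sup>+z. ennreal ((cmod (deriv f z))\<^sup>2 * \<omega> z) \<partial>disk_area)"

definition dirichlet_space :: "(complex \<Rightarrow> real) \<Rightarrow> (complex \<Rightarrow> complex) set"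
  where "dirichlet_space \<omega> = {f. f holomorphic_on unit_disk \<and> dirichlet_integral \<omega> f < \<infinity>}"

text \<open>
  Meaningful only on \<open>dirichlet_space \<omega>\<close>: outside it, \<open>enn2real\<close> replaces an infinite Dirichlet
  integral by \<open>0\<close>.
\<close>

definition dirichlet_norm :: "(complex \<Rightarrow> real) \<Rightarrow> (complex \<Rightarrow> complex) \<Rightarrow> real"
  where "dirichlet_norm \<omega> f = sqrt ((cmod (f 0))\<^sup>2 + enn2real (dirichlet_integral \<omega> f))"

definition cesaro_binomial :: "real \<Rightarrow> nat \<Rightarrow> real"
  where "cesaro_binomial \<alpha> n =
    Gamma (real n + \<alpha> + 1) / (Gamma (\<alpha> + 1) * Gamma (real n + 1))"

definition cesaro_mean :: "real \<Rightarrow> nat \<Rightarrow> (complex \<Rightarrow> complex) \<Rightarrow> complex \<Rightarrow> complex"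
  where "cesaro_mean \<alpha> n f z =
    inverse (of_real (cesaro_binomial \<alpha> n)) *
      (\<Sum>k=0..n. of_real (cesaro_binomial \<alpha> (n - k)) * fps_nth (fps_expansion f 0) k * z ^ k)"

definition omega1 :: "complex \<Rightarrow> real"
  where "omega1 z = (1 - (cmod z)\<^sup>2) / (cmod (1 - z))\<^sup>2"

end

theory Submission
  imports Defs "HOL-Real_Asymp.Real_Asymp"
begin

text \<open>
  For a power series \<open>f\<close> whose coefficients satisfy \<open>a (k + 1) = g k - g (k + 1)\<close> with a square
  summable \<open>g\<close>, the Dirichlet integral with weight \<open>\<omega>\<^sub>1\<close> equals \<open>\<Sum> \<bar>g k\<bar>\<^sup>2\<close>
  (\<open>dirichlet_integral_omega1_power_series\<close>); this is the local Dirichlet integral formula at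
  the boundary point \<open>1\<close>. Its proof here is a computation with coefficients: \<open>\<omega>\<^sub>1\<close> times
  \<open>\<bar>f'\<bar>\<^sup>2\<close> is the radial weight \<open>1 - \<bar>z\<bar>\<^sup>2\<close> times the squared modulus of the power series
  \<open>f' / (1 - z)\<close>, monomials are orthogonal for radial weights, and the resulting series
  telescopes.

  In terms of \<open>g\<close>, multiplying the coefficients of \<open>f\<close> by weights \<open>c k\<close> that vanish for large
  \<open>k\<close> becomes, after summation by parts, multiplication of \<open>g k\<close> by \<open>c (k + 1)\<close> minus the
  operator \<open>g \<mapsto> (\<Sum>j>k. (c j - c (j + 1)) * g j)\<close>. For the means of order \<open>1/2\<close> with index
  \<open>n\<close>, the drop \<open>c j - c (j + 1)\<close> is of size \<open>1 / sqrt (n * (n - j + 1))\<close>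
  (\<open>cesaro_weight_drop\<close>). Testing with \<open>g j = 1 / sqrt (n - j + 1)\<close> on \<open>n / 2 < j \<le> n\<close>, whose
  squared norm is about \<open>ln n\<close>, gives an image whose first \<open>n / 2\<close> entries are all about
  \<open>ln n / sqrt n\<close>, with squared norm about \<open>(ln n)\<^sup>2\<close>. So the norms of these operators are
  unbounded, and the uniform boundedness principle already forbids convergence for all \<open>f\<close>.

  The proof makes the divergent \<open>f\<close> explicit instead. The test sequences, divided by \<open>ln n\<close>
  (in fact by a harmonic number), are superposed along a sparse set of indices \<open>n\<close>
  (\<open>exists_resonant_sequence\<close>). The result is square summable, and because all entries and all
  drops are nonnegative, the contributions to the error cannot cancel
  (\<open>cesaro_error_lower_bound\<close>): along these indices the error norm stays bounded below.
\<close>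

section \<open>Rotation invariance of planar Lebesgue measure\<close>

text \<open>
  A linear isometry that carries the invariance of Lebesgue measure under orthogonal maps of
  \<open>real ^ 2\<close> over to \<open>complex\<close>.
\<close>

definition vec2_to_complex :: "real^2 \<Rightarrow> complex" where "vec2_to_complex x = Complex (x $ 1) (x $ 2)"

lemma vec2_to_complex_inner: "vec2_to_complex x \<bullet> vec2_to_complex y = x \<bullet> y"
  by (simp add: vec2_to_complex_def inner_complex_def inner_vec_def UNIV_2)

lemma linear_vec2_to_complex: "linear vec2_to_complex"
  by (rule linearI) (simp_all add: vec2_to_complex_def complex_eq_iff)

lemma bij_vec2_to_complex: "bij vec2_to_complex"
proof (rule o_bij)
  show "(\<lambda>z. vector [Re z, Im z]) \<circ> vec2_to_complex = id"
    by (auto simp: vec2_to_complex_def fun_eq_iff vec_eq_iff forall_2)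
  show "vec2_to_complex \<circ> (\<lambda>z. vector [Re z, Im z]) = id"
    by (auto simp: vec2_to_complex_def fun_eq_iff)
qed

lemma vec2_to_complex_measurable [measurable]: "vec2_to_complex \<in> borel_measurable borel"
  using linear_vec2_to_complex by (simp add: borel_measurable_continuous_onI linear_continuous_on linear_conv_bounded_linear)

text \<open>
  The isometry maps boxes onto boxes with the same side lengths, and boxes determine \<open>lborel\<close>.
\<close>

lemma lborel_complex_eq: "lborel = distr (lborel :: (real^2) measure) borel vec2_to_complex"
proof (rule lborel_eqI)
  fix l u :: complex
  assume le: "\<And>b. b \<in> Basis \<Longrightarrow> l \<bullet> b \<le> u \<bullet> b"
  have "vec2_to_complex -` box l u = box (vector [Re l, Im l]) (vector [Re u, Im u])"
    by (auto simp: vec2_to_complex_def mem_box_cart forall_2 in_box_complex_iff)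
  then show "emeasure (distr (lborel :: (real^2) measure) borel vec2_to_complex) (box l u) = (\<Prod>b\<in>Basis. (u - l) \<bullet> b)"
    using le[of 1] le[of \<i>]
    by (simp add: emeasure_distr emeasure_lborel_box_eq Basis_complex_def  Basis_vec_def UNIV_2 inner_axis axis_eq_axis)
qed simp

text \<open>
  Again it suffices to look at boxes. The preimage of a box under a rotation is, after
  transport to \<open>real ^ 2\<close>, the image of a box under an orthogonal map, whose measure is known.
\<close>

lemma lborel_rotate:
  assumes "cmod c = 1"
  shows "distr lborel borel ((*) c) = (lborel :: complex measure)"
proof (rule lborel_eqI [symmetric])
  fix l u :: complex
  assume le: "\<And>b. b \<in> Basis \<Longrightarrow> l \<bullet> b \<le> u \<bullet> b"
  \<comment> \<open>The rotation by \<open>inverse c\<close>, transported to \<open>real ^ 2\<close>.\<close>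
  define R where "R x = inv vec2_to_complex (inverse c * vec2_to_complex x)" for x
  have vec2_to_complex_R: "vec2_to_complex (R x) = inverse c * vec2_to_complex x" for x
    unfolding R_def using bij_vec2_to_complex by (simp add: bij_is_surj surj_f_inv_f)
  have c0: "c \<noteq> 0" using assms by auto
  have R: "orthogonal_transformation R"
    unfolding orthogonal_transformation
  proof
    show "linear R"
    proof (rule linearI)
      fix x y :: "real^2" and r :: real
      have "vec2_to_complex (R (x + y)) = vec2_to_complex (R x + R y)"
        by (simp add: vec2_to_complex_R linear_add[OF linear_vec2_to_complex] algebra_simps)
      then show "R (x + y) = R x + R y" using bij_vec2_to_complex by (simp add: bij_is_inj inj_eq)
      have "vec2_to_complex (R (r *\<^sub>R x)) = vec2_to_complex (r *\<^sub>R R x)"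
        by (simp add: vec2_to_complex_R linear_scale[OF linear_vec2_to_complex])
      then show "R (r *\<^sub>R x) = r *\<^sub>R R x" using bij_vec2_to_complex by (simp add: bij_is_inj inj_eq)
    qed
    have "norm (vec2_to_complex x) = norm x" for x by (simp add: norm_eq_sqrt_inner vec2_to_complex_inner)
    then show "\<forall>v. norm (R v) = norm v" by (metis assms vec2_to_complex_R mult_cancel_right1 norm_inverse norm_mult inverse_1)
  qed
  have *: "vec2_to_complex -` (*) c -` box l u = R ` (vec2_to_complex -` box l u)"
  proof (intro equalityI subsetI)
    fix x assume x: "x \<in> vec2_to_complex -` (*) c -` box l u"
    obtain y where y: "vec2_to_complex y = c * vec2_to_complex x" using bij_vec2_to_complex by (metis bij_pointE)
    have "vec2_to_complex (R y) = vec2_to_complex x" using c0 by (simp add: vec2_to_complex_R y)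
    then have "x = R y" using bij_vec2_to_complex by (simp add: bij_is_inj inj_eq)
    then show "x \<in> R ` (vec2_to_complex -` box l u)" using x y by auto
  next
    fix x assume "x \<in> R ` (vec2_to_complex -` box l u)"
    then show "x \<in> vec2_to_complex -` (*) c -` box l u" using c0 by (auto simp: vec2_to_complex_R field_simps)
  qed
  define B where "B = vec2_to_complex -` box l u"
  have B: "B = box (vector [Re l, Im l]) (vector [Re u, Im u])"
    by (auto simp: B_def vec2_to_complex_def mem_box_cart forall_2 in_box_complex_iff)
  have Bm: "B \<in> lmeasurable" by (simp add: B)
  have RB: "R ` B \<in> sets borel"
  proof -
    have "(\<lambda>x. c * vec2_to_complex x) \<in> borel_measurable borel" by measurable
    then have "(\<lambda>x. c * vec2_to_complex x) -` box l u \<in> sets borel"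
      by (rule measurable_sets_borel) simp
    moreover have "(\<lambda>x. c * vec2_to_complex x) -` box l u = R ` B"
      using * by (simp add: B_def vimage_def)
    ultimately show ?thesis by simp
  qed
  have "emeasure (distr lborel borel ((*) c)) (box l u) = emeasure lborel ((*) c -` box l u)"
    using measurable_sets_borel[of "(*) c" borel "box l u"] by (simp add: emeasure_distr)
  also have "\<dots> = emeasure lborel (R ` B)"
    unfolding B_def
    using measurable_sets_borel[of "(*) c" borel "box l u"]
    by (subst lborel_complex_eq, subst emeasure_distr) (auto simp: * )
  also have "\<dots> = emeasure lebesgue (R ` B)" using RB by simp
  also have "\<dots> = measure lebesgue (R ` B)"
    using measurable_orthogonal_image[OF R Bm] by (simp add: emeasure_eq_measure2 fmeasurableD2)
  also have "\<dots> = measure lebesgue B" using measure_orthogonal_image[OF R Bm] by simp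
  also have "\<dots> = emeasure lebesgue B" using Bm by (simp add: emeasure_eq_measure2 fmeasurableD2)
  also have "\<dots> = emeasure lborel B" by (simp add: B)
  also have "\<dots> = emeasure lborel (box l u)"
    using arg_cong[OF lborel_complex_eq, of "\<lambda>M. emeasure M (box l u)"]
    by (simp add: B_def emeasure_distr)
  also have "\<dots> = (\<Prod>b\<in>Basis. (u - l) \<bullet> b)" using le by (simp add: emeasure_lborel_box_eq)
  finally show "emeasure (distr lborel borel ((*) c)) (box l u) = (\<Prod>b\<in>Basis. (u - l) \<bullet> b)" .
qed simp


section \<open>Orthogonality and moments on the disk\<close>

lemma emeasure_disk: "emeasure lborel (ball (0::complex) r) = ennreal (pi * r\<^sup>2)" if "r \<ge> 0"
  using that by (simp add: emeasure_ball unit_ball_vol_2)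

lemma finite_measure_disk_area: "finite_measure disk_area"
  by (rule finite_measureI) (simp add: disk_area_def emeasure_disk ennreal_divide_eq_top_iff)

lemma space_disk_area [simp]: "space disk_area = UNIV"
  and sets_disk_area [simp, measurable_cong]: "sets disk_area = sets borel"
  by (simp_all add: disk_area_def)

lemma AE_disk_area: "AE z in disk_area. z \<in> unit_disk"
  unfolding disk_area_def by (rule AE_uniform_measureI) auto

lemma disk_area_rotate:
  assumes "cmod c = 1"
  shows "distr disk_area borel ((*) c) = disk_area"
proof (rule measure_eqI)
  fix A assume "A \<in> sets (distr disk_area borel ((*) c))"
  then have A [measurable]: "A \<in> sets borel" by simp
  have "(*) c -` (unit_disk \<inter> A) = unit_disk \<inter> (*) c -` A"
    using assms by (auto simp: norm_mult)
  moreover have "(*) c -` A \<in> sets borel"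
    using measurable_sets_borel[of "(*) c" borel A] by simp
  moreover have "emeasure lborel (unit_disk \<inter> A) = emeasure lborel ((*) c -` (unit_disk \<inter> A))"
    by (subst lborel_rotate[OF assms, symmetric], subst emeasure_distr) auto
  ultimately show "emeasure (distr disk_area borel ((*) c)) A = emeasure disk_area A"
    by (simp add: emeasure_distr disk_area_def)
qed simp

text \<open>
  Rotating by the angle \<open>\<pi> / (m - n)\<close> multiplies the integrand by \<open>- 1\<close> but leaves the
  integral unchanged.
\<close>

lemma disk_area_orthogonal:
  assumes "m \<noteq> n"
  shows "(\<integral>z. z ^ m * cnj z ^ n * of_real (1 - (cmod z)\<^sup>2) \<partial>disk_area) = 0"
proof -
  define c where "c = cis (pi / (real m - real n))"
  define F where "F z = z ^ m * cnj z ^ n * of_real (1 - (cmod z)\<^sup>2)" for z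
  have [measurable]: "F \<in> borel_measurable borel"
    unfolding F_def by (intro borel_measurable_continuous_onI continuous_intros)
  have c1: "cmod c = 1" by (simp add: c_def)
  define \<theta> where "\<theta> = pi / (real m - real n)"
  have "c ^ m * cnj c ^ n = cis (real m * \<theta>) * cis (real n * - \<theta>)"
    unfolding c_def \<theta>_def cis_cnj Complex.DeMoivre ..
  also have "\<dots> = cis ((real m - real n) * \<theta>)"
    by (simp only: cis_mult left_diff_distrib mult_minus_right flip: diff_conv_add_uminus)
  also have "(real m - real n) * \<theta> = pi"
    using assms by (simp add: \<theta>_def)
  finally have c2: "c ^ m * cnj c ^ n = - 1" by simp
  have "F (c * z) = - F z" for z
  proof -
    have "F (c * z) = (c ^ m * cnj c ^ n) * F z"
      by (simp add: F_def norm_mult c1 power_mult_distrib mult_ac)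
    then show ?thesis by (simp add: c2)
  qed
  moreover have "(\<integral>z. F z \<partial>disk_area) = (\<integral>z. F (c * z) \<partial>disk_area)"
    by (subst disk_area_rotate[OF c1, symmetric], subst integral_distr) auto
  ultimately have "(\<integral>z. F z \<partial>disk_area) = - (\<integral>z. F z \<partial>disk_area)" by simp
  then show ?thesis by (simp add: F_def)
qed

text \<open>
  A disk of radius \<open>sqrt t\<close> has normalized area \<open>t\<close>, so the squared modulus of a uniformly
  distributed point is uniformly distributed on the unit interval. This replaces polar
  coordinates in the computation of the radial moments.
\<close>

lemma disk_area_radial:
  "distr disk_area borel (\<lambda>z. (cmod z)\<^sup>2) = uniform_measure lborel {0..<1}"
proof (rule measure_eqI_lessThan)
  fix x :: real
  show "emeasure (distr disk_area borel (\<lambda>z. (cmod z)\<^sup>2)) {x<..} < \<infinity>"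
    by (simp add: emeasure_distr finite_measure.emeasure_finite[OF finite_measure_disk_area] less_top[symmetric])
  have l: "emeasure (distr disk_area borel (\<lambda>z. (cmod z)\<^sup>2)) {x<..} =
    emeasure lborel (unit_disk \<inter> {z. x < (cmod z)\<^sup>2}) / ennreal pi"
    by (simp add: emeasure_distr disk_area_def emeasure_disk vimage_def)
  have r: "emeasure (uniform_measure lborel {0..<1}) {x<..} = emeasure lborel ({0..<1} \<inter> {x<..})"
    by (simp add: divide_ennreal_def)
  consider "x < 0" | "0 \<le> x" "x < 1" | "1 \<le> x" by linarith
  then show "emeasure (distr disk_area borel (\<lambda>z. (cmod z)\<^sup>2)) {x<..} = emeasure (uniform_measure lborel {0..<1}) {x<..}"
  proof cases
    case 1
    then have "unit_disk \<inter> {z. x < (cmod z)\<^sup>2} = unit_disk"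
      by (auto intro: less_le_trans)
    moreover have "{0..<1} \<inter> {x<..} = {0..<1}" using 1 by auto
    ultimately show ?thesis by (simp add: l r emeasure_disk divide_ennreal)
  next
    case 2
    have "unit_disk \<inter> {z. x < (cmod z)\<^sup>2} = unit_disk - cball 0 (sqrt x)"
    proof -
      have "{z. x < (cmod z)\<^sup>2} = - cball 0 (sqrt x)"
        using real_sqrt_less_iff[of x "(cmod _)\<^sup>2"] by (intro set_eqI) (simp add: not_le)
      then show ?thesis by (simp only: Diff_eq)
    qed
    also have "emeasure lborel \<dots> = emeasure lborel unit_disk - emeasure lborel (cball (0::complex) (sqrt x))"
    proof (rule emeasure_Diff)
      show "emeasure lborel (cball (0::complex) (sqrt x)) \<noteq> \<infinity>"
        using emeasure_lborel_cball_finite by (simp add: less_top)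
      have "sqrt x < 1" using 2 by simp
      then show "cball 0 (sqrt x) \<subseteq> unit_disk" by (simp add: cball_subset_ball_iff)
    qed auto
    also have "\<dots> = ennreal (pi * (1 - x))"
      using 2 by (simp add: emeasure_disk emeasure_cball unit_ball_vol_2 right_diff_distrib flip: ennreal_minus)
    finally have "emeasure lborel (unit_disk \<inter> {z. x < (cmod z)\<^sup>2}) = ennreal (pi * (1 - x))" .
    moreover have "{0..<1} \<inter> {x<..} = {x<..<1}" using 2 by auto
    ultimately show ?thesis using 2 by (simp add: l r divide_ennreal)
  next
    case 3
    have "(cmod z)\<^sup>2 \<le> 1" if "z \<in> unit_disk" for z :: complex
      using that by (simp add: abs_square_le_1)
    then have "unit_disk \<inter> {z. x < (cmod z)\<^sup>2} = {}"
      using 3 by fastforce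
    moreover have "{0..<1} \<inter> {x<..} = {}" using 3 by auto
    ultimately show ?thesis by (simp add: l r)
  qed
qed auto

lemma disk_area_moment:
  "(\<integral>z. (cmod z) ^ (2 * m) * (1 - (cmod z)\<^sup>2) \<partial>disk_area) = 1 / ((real m + 1) * (real m + 2))"
proof -
  have "(\<integral>z. (cmod z) ^ (2 * m) * (1 - (cmod z)\<^sup>2) \<partial>disk_area)
    = (\<integral>t. t ^ m * (1 - t) \<partial>distr disk_area borel (\<lambda>z. (cmod z)\<^sup>2))"
    by (subst integral_distr) (auto simp: power_mult)
  also have "\<dots> = (\<integral>t. t ^ m * (1 - t) * indicator {0..<1} t \<partial>lborel)"
  proof -
    have "uniform_measure lborel {0..<1} = density lborel (\<lambda>t. ennreal (indicator {0..<1::real} t))"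
      unfolding uniform_measure_def by (intro density_cong) (auto simp: indicator_def divide_ennreal_def)
    then show ?thesis
      unfolding disk_area_radial by (simp add: integral_density mult_ac)
  qed
  also have "\<dots> = (\<integral>t. t ^ m * (1 - t) * indicator {0..1} t \<partial>lborel)"
    by (intro Bochner_Integration.integral_cong) (auto simp: indicator_def)
  also have "\<dots> = (1 ^ (m+1) / (m+1) - 1 ^ (m+2) / (m+2)) - (0 ^ (m+1) / (m+1) - 0 ^ (m+2) / (m+2))"
  proof (rule integral_FTC_Icc_real)
    have pow: "((\<lambda>t. t ^ (k+1) / (k+1)) has_real_derivative t ^ k) (at t)" for k and t :: real
      by (rule DERIV_cong, rule DERIV_cdivide, rule DERIV_pow) (simp add: add.commute)
    show "((\<lambda>t. t ^ (m+1) / (m+1) - t ^ (m+2) / (m+2)) has_real_derivative t ^ m * (1 - t)) (at t)" for t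
      using DERIV_diff[OF pow[of m t] pow[of "Suc m" t]]
      by (simp add: left_diff_distrib add.commute mult.commute)
    show "isCont (\<lambda>t. t ^ m * (1 - t)) t" for t :: real by (intro continuous_intros)
  qed simp
  also have "\<dots> = 1 / ((real m + 1) * (real m + 2))" by (simp add: field_simps)
  finally show ?thesis .
qed


lemma integrable_disk_area_continuous:
  fixes F :: "complex \<Rightarrow> 'a::{banach, second_countable_topology}"
  assumes "continuous_on UNIV F"
  shows "integrable disk_area F"
proof -
  have "compact (F ` cball 0 1)"
    using assms by (intro compact_continuous_image compact_cball) (auto intro: continuous_on_subset)
  then obtain B where "\<And>z. z \<in> cball 0 1 \<Longrightarrow> norm (F z) \<le> B"
    by (metis bounded_iff compact_imp_bounded image_eqI)
  then have "AE z in disk_area. norm (F z) \<le> B"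
    using AE_disk_area by (auto elim!: eventually_mono)
  moreover have "F \<in> borel_measurable disk_area"
    using borel_measurable_continuous_onI[OF assms] by simp
  ultimately show ?thesis
    by (rule finite_measure.integrable_const_bound[OF finite_measure_disk_area])
qed

section \<open>A Parseval identity for the weight \<open>1 - \<bar>z\<bar>\<^sup>2\<close>\<close>

text \<open>
  On holomorphic functions, this is the squared norm of the Bergman space with the standard
  weight \<open>1 - \<bar>z\<bar>\<^sup>2\<close>.
\<close>

definition weighted_sq_norm :: "(complex \<Rightarrow> complex) \<Rightarrow> ennreal" where
  "weighted_sq_norm u = (\<integral>\<^sup>+z. ennreal ((cmod (u z))\<^sup>2 * (1 - (cmod z)\<^sup>2)) \<partial>disk_area)"

lemma weighted_sq_norm_cong:
  assumes "\<And>z. cmod z < 1 \<Longrightarrow> u z = v z"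
  shows "weighted_sq_norm u = weighted_sq_norm v"
  unfolding weighted_sq_norm_def
  by (rule nn_integral_cong_AE) (use AE_disk_area assms in \<open>auto elim!: eventually_mono\<close>)

text \<open>
  Expanding the square gives products of monomials; orthogonality removes those with different
  exponents, and the radial moments evaluate the others.
\<close>

lemma weighted_sq_norm_polynomial:
  "weighted_sq_norm (\<lambda>z. \<Sum>m<N. q m * z ^ m) =
    ennreal (\<Sum>m<N. (cmod (q m))\<^sup>2 / ((real m + 1) * (real m + 2)))"
proof -
  define P where "P z = (\<Sum>m<N. q m * z ^ m)" for z
  define F where "F z = (cmod (P z))\<^sup>2 * (1 - (cmod z)\<^sup>2)" for z
  define E where "E m n z = z ^ m * cnj z ^ n * of_real (1 - (cmod z)\<^sup>2)" for m n and z :: complex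
  have contP: "continuous_on UNIV P" unfolding P_def by (intro continuous_intros)
  have F: "integrable disk_area F"
    unfolding F_def by (intro integrable_disk_area_continuous continuous_intros contP)
  have E: "integrable disk_area (E m n)" for m n
    unfolding E_def by (intro integrable_disk_area_continuous continuous_intros)
  have int_E: "(\<integral>z. E m n z \<partial>disk_area) = (if m = n then of_real (1 / ((real m + 1) * (real m + 2))) else 0)" for m n
  proof (cases "m = n")
    case True
    have "E m m z = of_real (cmod z ^ (2 * m) * (1 - (cmod z)\<^sup>2))" for z
    proof -
      have "z ^ m * cnj z ^ m = of_real (cmod z ^ (2 * m))"
        by (metis complex_norm_square of_real_power power_mult power_mult_distrib)
      then show ?thesis by (simp add: E_def)
    qed
    then have "(\<integral>z. E m m z \<partial>disk_area) = of_real (\<integral>z. cmod z ^ (2 * m) * (1 - (cmod z)\<^sup>2) \<partial>disk_area)"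
      by (simp only: integral_complex_of_real)
    then show ?thesis unfolding disk_area_moment using True by simp
  next
    case False
    then show ?thesis unfolding E_def by (simp only: disk_area_orthogonal[OF False] False if_False)
  qed
  have FE: "complex_of_real (F z) = (\<Sum>m<N. \<Sum>n<N. q m * cnj (q n) * E m n z)" for z
  proof -
    have "complex_of_real (F z) = P z * cnj (P z) * of_real (1 - (cmod z)\<^sup>2)"
      by (simp only: F_def of_real_mult complex_norm_square)
    also have "\<dots> = (\<Sum>m<N. \<Sum>n<N. q m * cnj (q n) * E m n z)"
      unfolding P_def cnj_sum sum_product
      unfolding sum_distrib_right E_def by (intro sum.cong refl) (simp add: mult_ac)
    finally show ?thesis .
  qed
  have "complex_of_real (\<integral>z. F z \<partial>disk_area) = (\<integral>z. complex_of_real (F z) \<partial>disk_area)"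
    by (simp only: integral_complex_of_real)
  also have "\<dots> = (\<Sum>m<N. \<Sum>n<N. q m * cnj (q n) * (\<integral>z. E m n z \<partial>disk_area))"
    unfolding FE using E by (simp add: integral_sum)
  also have "\<dots> = of_real (\<Sum>m<N. (cmod (q m))\<^sup>2 / ((real m + 1) * (real m + 2)))"
    unfolding int_E of_real_sum
    by (intro sum.cong) (simp_all add: if_distrib cong: if_cong flip: complex_norm_square of_real_power)
  finally have "(\<integral>z. F z \<partial>disk_area) = (\<Sum>m<N. (cmod (q m))\<^sup>2 / ((real m + 1) * (real m + 2)))"
    by (simp only: of_real_eq_iff)
  moreover have "AE z in disk_area. 0 \<le> F z"
    using AE_disk_area
    by (rule eventually_mono) (auto simp: F_def abs_square_le_1 intro!: mult_nonneg_nonneg)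
  ultimately have "(\<integral>\<^sup>+z. ennreal (F z) \<partial>disk_area) =
      ennreal (\<Sum>m<N. (cmod (q m))\<^sup>2 / ((real m + 1) * (real m + 2)))"
    using nn_integral_eq_integral[OF F] by simp
  then show ?thesis by (simp only: weighted_sq_norm_def F_def P_def)
qed

text \<open>
  A triangle inequality for squares. A small \<open>\<epsilon>\<close> keeps the constant in front of \<open>b\<close> close to
  \<open>1\<close>, at the cost of a large constant in front of the error \<open>b - a\<close>.
\<close>

lemma norm_square_le_weighted_triangle:
  fixes a b :: complex
  assumes "\<epsilon> > 0"
  shows "(cmod a)\<^sup>2 \<le> (1 + \<epsilon>) * (cmod b)\<^sup>2 + (1 + 1 / \<epsilon>) * (cmod (b - a))\<^sup>2"
proof -
  have "cmod a \<le> cmod b + cmod (b - a)"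
    by (metis norm_minus_commute norm_triangle_sub)
  then have "(cmod a)\<^sup>2 \<le> (cmod b + cmod (b - a))\<^sup>2" by simp
  moreover have "0 \<le> (\<epsilon> * cmod b - cmod (b - a))\<^sup>2 / \<epsilon>" using assms by simp
  moreover have "(\<epsilon> * cmod b - cmod (b - a))\<^sup>2 / \<epsilon> =
    \<epsilon> * (cmod b)\<^sup>2 - 2 * cmod b * cmod (b - a) + (cmod (b - a))\<^sup>2 / \<epsilon>"
    using assms by (simp add: power2_eq_square field_simps)
  ultimately show ?thesis by (simp add: power2_sum algebra_simps)
qed

text \<open>
  The partial sums \<open>P M\<close> converge to the full sum \<open>Q\<close> pointwise on the disk. Fatou's lemma
  therefore bounds the norm of \<open>Q - P M\<close> by the tail of the series on the right, which for
  \<open>M = 0\<close> is the upper bound. The lower bound follows since \<open>P M\<close> is close to \<open>Q\<close> in norm and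
  the norm of \<open>P M\<close> is known exactly.
\<close>

lemma weighted_sq_norm_power_series:
  assumes conv: "\<And>z. cmod z < 1 \<Longrightarrow> summable (\<lambda>m. q m * z ^ m)"
    and S: "summable (\<lambda>m. (cmod (q m))\<^sup>2 / ((real m + 1) * (real m + 2)))"
  shows "weighted_sq_norm (\<lambda>z. \<Sum>m. q m * z ^ m) =
    ennreal (\<Sum>m. (cmod (q m))\<^sup>2 / ((real m + 1) * (real m + 2)))"
proof -
  define t where "t m = (cmod (q m))\<^sup>2 / ((real m + 1) * (real m + 2))" for m
  define P where "P N z = (\<Sum>m<N. q m * z ^ m)" for N z
  define Q where "Q z = (\<Sum>m. q m * z ^ m)" for z
  have t0: "t m \<ge> 0" for m by (simp add: t_def)
  have St: "summable t" using S by (simp add: t_def[abs_def])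
  have [measurable]: "P N \<in> borel_measurable borel" for N
    unfolding P_def by (intro borel_measurable_continuous_onI continuous_intros)
  have [measurable]: "Q \<in> borel_measurable borel" unfolding Q_def by measurable
  have lim: "(\<lambda>N. P N z) \<longlonglongrightarrow> Q z" if "cmod z < 1" for z
    unfolding P_def Q_def using summable_LIMSEQ[OF conv[OF that]] .
  have tail: "weighted_sq_norm (\<lambda>z. Q z - P M z) \<le> ennreal (suminf t - sum t {..<M})" for M
  proof -
    define u where "u K z = ennreal ((cmod (P K z - P M z))\<^sup>2 * (1 - (cmod z)\<^sup>2))" for K z
    have "weighted_sq_norm (\<lambda>z. Q z - P M z) = (\<integral>\<^sup>+z. liminf (\<lambda>K. u K z) \<partial>disk_area)"
      unfolding weighted_sq_norm_def
    proof (rule nn_integral_cong_AE, rule eventually_mono[OF AE_disk_area])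
      fix z :: complex assume "z \<in> unit_disk"
      then have "(\<lambda>K. u K z) \<longlonglongrightarrow> ennreal ((cmod (Q z - P M z))\<^sup>2 * (1 - (cmod z)\<^sup>2))"
        unfolding u_def by (intro tendsto_intros tendsto_ennrealI lim) simp
      then show "ennreal ((cmod (Q z - P M z))\<^sup>2 * (1 - (cmod z)\<^sup>2)) = liminf (\<lambda>K. u K z)"
        by (simp add: lim_imp_Liminf)
    qed
    also have "\<dots> \<le> liminf (\<lambda>K. \<integral>\<^sup>+z. u K z \<partial>disk_area)"
      by (rule nn_integral_liminf) (simp add: u_def)
    also have "\<dots> \<le> liminf (\<lambda>K::nat. ennreal (suminf t - sum t {..<M}))"
    proof (rule Liminf_mono, rule eventually_mono[OF eventually_ge_at_top[of M]])
      fix K assume K: "M \<le> K"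
      let ?q = "\<lambda>m. if m < M then 0 else q m"
      have "P K z - P M z = (\<Sum>m<K. ?q m * z ^ m)" for z
      proof -
        have "(\<Sum>m<K. ?q m * z ^ m) = (\<Sum>m\<in>{..<K} - {..<M}. q m * z ^ m)"
          by (intro sum.mono_neutral_cong_right) auto
        also have "\<dots> = P K z - P M z"
          unfolding P_def using K by (intro sum_diff) auto
        finally show ?thesis by simp
      qed
      then have "(\<integral>\<^sup>+z. u K z \<partial>disk_area) = weighted_sq_norm (\<lambda>z. \<Sum>m<K. ?q m * z ^ m)"
        unfolding u_def weighted_sq_norm_def by simp
      also have "\<dots> = ennreal (\<Sum>m\<in>{..<K} - {..<M}. t m)"
        unfolding weighted_sq_norm_polynomial t_def
        by (intro arg_cong[of _ _ ennreal] sum.mono_neutral_cong_right) auto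
      also have "\<dots> \<le> ennreal (suminf t - sum t {..<M})"
        using K sum_le_suminf[OF St, of "{..<K}"] t0 by (subst sum_diff) (auto intro!: ennreal_leI)
      finally show "(\<integral>\<^sup>+z. u K z \<partial>disk_area) \<le> ennreal (suminf t - sum t {..<M})" .
    qed
    finally show ?thesis by (simp add: Liminf_const)
  qed
  have upper: "weighted_sq_norm Q \<le> ennreal (suminf t)" using tail[of 0] by (simp add: P_def)
  then obtain x where x: "weighted_sq_norm Q = ennreal x" "x \<ge> 0"
    by (metis ennreal_cases ennreal_less_top less_le_not_le top_greatest)
  have "suminf t \<le> x"
  proof (rule field_le_epsilon)
    fix e :: real assume "e > 0"
    \<comment> \<open>Any positive \<open>\<epsilon>\<close> with \<open>\<epsilon> * x \<le> e\<close> would do; the summand \<open>1\<close> covers the case \<open>x = 0\<close>.\<close>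
    define \<epsilon> where "\<epsilon> = e / (x + 1)"
    have \<epsilon>: "\<epsilon> > 0" using \<open>e > 0\<close> x by (simp add: \<epsilon>_def)
    have "sum t {..<M} \<le> (1 + \<epsilon>) * x + (1 + 1 / \<epsilon>) * (suminf t - sum t {..<M})" for M
    proof -
      have tail0: "suminf t - sum t {..<M} \<ge> 0"
        using sum_le_suminf[OF St, of "{..<M}"] t0 by simp
      have "ennreal (sum t {..<M}) = weighted_sq_norm (P M)"
        unfolding P_def weighted_sq_norm_polynomial t_def ..
      also have "\<dots> \<le> (\<integral>\<^sup>+z. ennreal (1 + \<epsilon>) * ennreal ((cmod (Q z))\<^sup>2 * (1 - (cmod z)\<^sup>2)) +
          ennreal (1 + 1 / \<epsilon>) * ennreal ((cmod (Q z - P M z))\<^sup>2 * (1 - (cmod z)\<^sup>2)) \<partial>disk_area)"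
        unfolding weighted_sq_norm_def
      proof (rule nn_integral_mono_AE, rule eventually_mono[OF AE_disk_area])
        fix z :: complex assume "z \<in> unit_disk"
        then have w: "0 \<le> 1 - (cmod z)\<^sup>2" by (simp add: abs_square_le_1)
        have "(cmod (P M z))\<^sup>2 * (1 - (cmod z)\<^sup>2) \<le>
          ((1 + \<epsilon>) * (cmod (Q z))\<^sup>2 + (1 + 1 / \<epsilon>) * (cmod (Q z - P M z))\<^sup>2) * (1 - (cmod z)\<^sup>2)"
          using norm_square_le_weighted_triangle[OF \<epsilon>] w by (rule mult_right_mono)
        also have "\<dots> = (1 + \<epsilon>) * ((cmod (Q z))\<^sup>2 * (1 - (cmod z)\<^sup>2)) +
          (1 + 1 / \<epsilon>) * ((cmod (Q z - P M z))\<^sup>2 * (1 - (cmod z)\<^sup>2))"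
          by (simp only: distrib_right mult.assoc)
        finally show "ennreal ((cmod (P M z))\<^sup>2 * (1 - (cmod z)\<^sup>2)) \<le>
          ennreal (1 + \<epsilon>) * ennreal ((cmod (Q z))\<^sup>2 * (1 - (cmod z)\<^sup>2)) +
          ennreal (1 + 1 / \<epsilon>) * ennreal ((cmod (Q z - P M z))\<^sup>2 * (1 - (cmod z)\<^sup>2))"
          using \<epsilon> w by (simp add: ennreal_leI flip: ennreal_mult ennreal_plus)
      qed
      also have "\<dots> = ennreal (1 + \<epsilon>) * weighted_sq_norm Q +
          ennreal (1 + 1 / \<epsilon>) * weighted_sq_norm (\<lambda>z. Q z - P M z)"
        unfolding weighted_sq_norm_def by (subst nn_integral_add) (simp_all add: nn_integral_cmult)
      also have "\<dots> \<le> ennreal (1 + \<epsilon>) * ennreal x +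
          ennreal (1 + 1 / \<epsilon>) * ennreal (suminf t - sum t {..<M})"
        using tail[of M] by (intro add_mono mult_left_mono) (auto simp: x)
      also have "\<dots> = ennreal ((1 + \<epsilon>) * x + (1 + 1 / \<epsilon>) * (suminf t - sum t {..<M}))"
        using \<epsilon> x tail0 by (simp add: ennreal_mult ennreal_plus)
      finally show ?thesis using \<epsilon> x tail0 by (subst (asm) ennreal_le_iff) auto
    qed
    moreover have "(\<lambda>M. (1 + \<epsilon>) * x + (1 + 1 / \<epsilon>) * (suminf t - sum t {..<M}))
        \<longlonglongrightarrow> (1 + \<epsilon>) * x + (1 + 1 / \<epsilon>) * (suminf t - suminf t)"
      by (intro tendsto_intros summable_LIMSEQ St)
    ultimately have "suminf t \<le> (1 + \<epsilon>) * x + (1 + 1 / \<epsilon>) * (suminf t - suminf t)"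
      using summable_LIMSEQ[OF St] by (intro LIMSEQ_le) auto
    also have "\<dots> = x + e * (x / (x + 1))" by (simp add: \<epsilon>_def algebra_simps)
    also have "x / (x + 1) \<le> 1" using x by simp
    then have "x + e * (x / (x + 1)) \<le> x + e" 
      using \<open>e > 0\<close> mult_left_mono[of "x / (x + 1)" 1 e] by simp
    finally show "suminf t \<le> x + e" .
  qed
  with upper x have "weighted_sq_norm Q = ennreal (suminf t)"
    by (auto intro!: antisym ennreal_leI)
  then show ?thesis by (simp add: Q_def[abs_def] t_def[abs_def])
qed


section \<open>The Dirichlet integral as an \<open>l\<^sup>2\<close> norm\<close>

lemma power_series_sums_deriv:
  fixes f :: "complex \<Rightarrow> complex"
  assumes f: "\<And>z. cmod z < 1 \<Longrightarrow> (\<lambda>k. a k * z ^ k) sums f z" and z: "cmod z < 1"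
  shows has_field_derivative_power_series: "(f has_field_derivative (\<Sum>k. diffs a k * z ^ k)) (at z)"
    and summable_norm_diffs: "summable (\<lambda>k. norm (diffs a k * z ^ k))"
proof -
  define K :: complex where "K = of_real ((1 + cmod z) / 2)"
  have K: "cmod z < cmod K" "cmod K < 1" using z by (simp_all add: K_def norm_divide del: of_real_divide of_real_add)
  have S: "summable (\<lambda>k. a k * w ^ k)" if "cmod w < 1" for w
    using f[OF that] by (rule sums_summable)
  have "((\<lambda>z. \<Sum>k. a k * z ^ k) has_field_derivative (\<Sum>k. diffs a k * z ^ k)) (at z)"
    by (rule termdiffs_strong[OF S[OF K(2)] K(1)])
  then show "(f has_field_derivative (\<Sum>k. diffs a k * z ^ k)) (at z)"
    by (rule has_field_derivative_transform_within_open[where S=unit_disk])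
       (use z f in \<open>auto simp: sums_iff\<close>)
  have "summable (\<lambda>k. diffs a k * K ^ k)"
    by (rule termdiff_converges[OF K(2)]) (rule S)
  then show "summable (\<lambda>k. norm (diffs a k * z ^ k))"
    by (rule powser_insidea) (rule K(1))
qed

text \<open>
  The Cauchy--Schwarz inequality alone only gives boundedness. Applying it to the terms from a
  late index \<open>N\<close> on gives a bound by a small tail, while the first \<open>N\<close> terms contribute a
  constant that the denominator kills.
\<close>

lemma partial_sums_of_l2_over_sqrt_tendsto_0:
  fixes g :: "nat \<Rightarrow> complex"
  assumes g: "summable (\<lambda>k. (cmod (g k))\<^sup>2)"
  shows "(\<lambda>n. (cmod (\<Sum>k\<le>n. g k))\<^sup>2 / (real n + 1)) \<longlonglongrightarrow> 0"
proof (rule LIMSEQ_I)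
  fix e :: real assume e: "e > 0"
  define t where "t k = (cmod (g k))\<^sup>2" for k
  have "(\<lambda>N. \<Sum>k. t (k + N)) \<longlonglongrightarrow> 0"
    using g unfolding t_def by (rule suminf_exist_split2)
  then have "\<forall>\<^sub>F N in sequentially. (\<Sum>k. t (k + N)) < e / 4"
    using e by (intro order_tendstoD) auto
  then obtain N where N: "(\<Sum>k. t (k + N)) < e / 4"
    by (auto simp: eventually_sequentially)
  define C where "C = (cmod (\<Sum>k<N. g k))\<^sup>2"
  have bound: "(cmod (\<Sum>k\<le>n. g k))\<^sup>2 / (real n + 1) \<le> 2 * C / (real n + 1) + e / 2" if n: "n \<ge> N" for n
  proof -
    have "(\<Sum>k\<le>n. g k) = (\<Sum>k<N. g k) + (\<Sum>k=N..n. g k)"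
    proof -
      have "{..n} = {..<N} \<union> {N..n}" using n by auto
      then show ?thesis by (simp only:) (intro sum.union_disjoint, auto)
    qed
    then have "cmod (\<Sum>k\<le>n. g k) \<le> cmod (\<Sum>k<N. g k) + cmod (\<Sum>k=N..n. g k)"
      by (simp add: norm_triangle_ineq)
    then have "(cmod (\<Sum>k\<le>n. g k))\<^sup>2 \<le> (cmod (\<Sum>k<N. g k) + cmod (\<Sum>k=N..n. g k))\<^sup>2" by simp
    also have "\<dots> \<le> 2 * C + 2 * (cmod (\<Sum>k=N..n. g k))\<^sup>2"
      using zero_le_power2[of "cmod (\<Sum>k<N. g k) - cmod (\<Sum>k=N..n. g k)"]
      by (simp add: C_def power2_sum power2_diff)
    finally have 1: "(cmod (\<Sum>k\<le>n. g k))\<^sup>2 \<le> 2 * C + 2 * (cmod (\<Sum>k=N..n. g k))\<^sup>2" .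
    have "(cmod (\<Sum>k=N..n. g k))\<^sup>2 \<le> (\<Sum>k=N..n. cmod (g k) * 1)\<^sup>2"
      by (intro power_mono) (simp_all add: norm_sum)
    also have "\<dots> \<le> (\<Sum>k=N..n. t k) * (\<Sum>k=N..n. 1\<^sup>2)"
      unfolding t_def by (rule Cauchy_Schwarz_ineq_sum)
    also have "\<dots> \<le> (e / 4) * (real n + 1)"
    proof (rule mult_mono)
      have "(\<Sum>k=N..n. t k) = (\<Sum>k<Suc n - N. t (k + N))"
        by (rule sum.reindex_bij_witness[of _ "\<lambda>k. k + N" "\<lambda>k. k - N"]) (use n in auto)
      also have "\<dots> \<le> (\<Sum>k. t (k + N))"
        using g by (intro sum_le_suminf) (auto simp: t_def intro: summable_ignore_initial_segment)
      finally show "(\<Sum>k=N..n. t k) \<le> e / 4" using N by simp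
    qed (use e n in auto)
    finally have "(cmod (\<Sum>k\<le>n. g k))\<^sup>2 \<le> 2 * C + (e / 2) * (real n + 1)" using 1 by simp
    then have "(cmod (\<Sum>k\<le>n. g k))\<^sup>2 / (real n + 1) \<le> (2 * C + (e / 2) * (real n + 1)) / (real n + 1)"
      by (intro divide_right_mono) auto
    also have "(2 * C + (e / 2) * (real n + 1)) / (real n + 1) = 2 * C / (real n + 1) + e / 2"
      by (simp add: field_simps)
    finally show ?thesis .
  qed
  have "(\<lambda>n. 2 * C / (real n + 1)) \<longlonglongrightarrow> 0" by real_asymp
  then have "\<forall>\<^sub>F n in sequentially. 2 * C / (real n + 1) < e / 2"
    using e by (intro order_tendstoD) auto
  then obtain M where M: "\<And>n. n \<ge> M \<Longrightarrow> 2 * C / (real n + 1) < e / 2"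
    by (auto simp: eventually_sequentially)
  show "\<exists>M. \<forall>n\<ge>M. norm ((cmod (\<Sum>k\<le>n. g k))\<^sup>2 / (real n + 1) - 0) < e"
  proof (intro exI allI impI)
    fix n assume "n \<ge> max M N"
    then show "norm ((cmod (\<Sum>k\<le>n. g k))\<^sup>2 / (real n + 1) - 0) < e"
      using bound[of n] M[of n] by simp
  qed
qed

text \<open>
  With \<open>s = g\<^sub>0 + \<dots> + g\<^sub>m\<close>, \<open>g = g\<^sub>m\<^sub>+\<^sub>1\<close> and \<open>n = m + 1\<close>, the last two terms on the right
  telescope when summed over \<open>m\<close>.
\<close>

lemma telescoping_identity_real:
  fixes s g n :: real
  assumes "n > 0"
  shows "(s - n * g)\<^sup>2 / (n * (n + 1)) = g\<^sup>2 + s\<^sup>2 / n - (s + g)\<^sup>2 / (n + 1)"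
  using assms by (simp add: divide_simps power2_eq_square) (simp add: algebra_simps)

lemma telescoping_identity:
  fixes s g :: complex and n :: real
  assumes "n > 0"
  shows "(cmod (s - of_real n * g))\<^sup>2 / (n * (n + 1)) =
    (cmod g)\<^sup>2 + (cmod s)\<^sup>2 / n - (cmod (s + g))\<^sup>2 / (n + 1)"
  using telescoping_identity_real[OF assms, of "Re s" "Re g"]
    telescoping_identity_real[OF assms, of "Im s" "Im g"]
  by (simp add: cmod_power2 add_divide_distrib)

text \<open>
  The hypothesis on the coefficients says that \<open>f\<close> differs by a constant from \<open>(z - 1)\<close> times
  the function with Taylor coefficients \<open>g\<close>. Since \<open>\<omega>\<^sub>1\<close> is \<open>1 - \<bar>z\<bar>\<^sup>2\<close> divided by
  \<open>\<bar>1 - z\<bar>\<^sup>2\<close>, the Dirichlet integral is the weighted norm of \<open>f' / (1 - z)\<close>. Division by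
  \<open>1 - z\<close> replaces the coefficients of \<open>f'\<close> by their partial sums \<open>q\<close>, and the Parseval
  identity turns the norm into a series to which the telescoping identity applies. The
  boundary term vanishes in the limit because \<open>g\<close> is square summable.
\<close>

lemma dirichlet_integral_omega1_power_series:
  fixes f :: "complex \<Rightarrow> complex"
  assumes f: "\<And>z. cmod z < 1 \<Longrightarrow> (\<lambda>k. a k * z ^ k) sums f z"
    and a: "\<And>k. a (Suc k) = g k - g (Suc k)"
    and g: "summable (\<lambda>k. (cmod (g k))\<^sup>2)"
  shows "dirichlet_integral omega1 f = ennreal (\<Sum>k. (cmod (g k))\<^sup>2)"
proof -
  define S where "S m = (\<Sum>k\<le>m. g k)" for m
  define q where "q m = (\<Sum>k\<le>m. diffs a k)" for m
  have q: "q m = S m - of_real (real m + 1) * g (Suc m)" for m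
    by (induction m) (simp_all add: q_def S_def diffs_def a algebra_simps)
  have series: "(\<lambda>m. q m * z ^ m) sums (deriv f z / (1 - z))" if z: "cmod z < 1" for z
  proof -
    have "(\<lambda>m. \<Sum>k\<le>m. (diffs a k * z ^ k) * z ^ (m - k)) sums
        ((\<Sum>k. diffs a k * z ^ k) * (\<Sum>k. z ^ k))"
      by (intro Cauchy_product_sums summable_norm_diffs[OF f z])
         (use z in \<open>simp_all add: norm_power summable_geometric\<close>)
    moreover have "(\<Sum>k\<le>m. (diffs a k * z ^ k) * z ^ (m - k)) = q m * z ^ m" for m
      unfolding q_def sum_distrib_right
      by (intro sum.cong) (simp_all add: mult.assoc flip: power_add)
    moreover have "deriv f z = (\<Sum>k. diffs a k * z ^ k)"
      by (intro DERIV_imp_deriv has_field_derivative_power_series[OF f z])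
    ultimately show ?thesis using z by (simp add: suminf_geometric)
  qed
  have partial: "(\<Sum>m<M. (cmod (q m))\<^sup>2 / ((real m + 1) * (real m + 2))) =
    (\<Sum>k<Suc M. (cmod (g k))\<^sup>2) - (cmod (S M))\<^sup>2 / (real M + 1)" for M
  proof (induction M)
    case 0
    show ?case by (simp add: S_def)
  next
    case (Suc M)
    have "(cmod (q M))\<^sup>2 / ((real M + 1) * (real M + 2)) = (cmod (g (Suc M)))\<^sup>2 +
        (cmod (S M))\<^sup>2 / (real M + 1) - (cmod (S (Suc M)))\<^sup>2 / (real (Suc M) + 1)"
      using telescoping_identity[of "real M + 1" "S M" "g (Suc M)"]
      by (simp add: q S_def add.commute add.left_commute)
    then show ?case using Suc.IH by simp
  qed
  have sums: "(\<lambda>m. (cmod (q m))\<^sup>2 / ((real m + 1) * (real m + 2))) sums (\<Sum>k. (cmod (g k))\<^sup>2)"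
  proof -
    have "(\<lambda>M. (\<Sum>k<Suc M. (cmod (g k))\<^sup>2) - (cmod (S M))\<^sup>2 / (real M + 1))
        \<longlonglongrightarrow> (\<Sum>k. (cmod (g k))\<^sup>2) - 0"
      unfolding S_def
      by (intro tendsto_diff partial_sums_of_l2_over_sqrt_tendsto_0 g LIMSEQ_Suc[OF summable_LIMSEQ[OF g]])
    then show ?thesis by (simp add: sums_def partial)
  qed
  have "dirichlet_integral omega1 f = weighted_sq_norm (\<lambda>z. deriv f z / (1 - z))"
    unfolding dirichlet_integral_def weighted_sq_norm_def omega1_def
    by (simp add: norm_divide power_divide)
  also have "\<dots> = weighted_sq_norm (\<lambda>z. \<Sum>m. q m * z ^ m)"
    using series by (intro weighted_sq_norm_cong) (simp add: sums_iff)
  also have "\<dots> = ennreal (\<Sum>k. (cmod (g k))\<^sup>2)"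
    using sums sums_summable[OF series] by (subst weighted_sq_norm_power_series) (simp_all add: sums_iff)
  finally show ?thesis .
qed


section \<open>The weights of the Cesaro means of order one half\<close>

lemma cesaro_binomial_0:
  assumes "\<alpha> > -1"
  shows "cesaro_binomial \<alpha> 0 = 1"
proof -
  have "0 < Gamma (\<alpha> + 1)" using assms by (intro Gamma_real_pos) linarith
  then have "Gamma (\<alpha> + 1) \<noteq> 0" by linarith
  then show ?thesis by (simp add: cesaro_binomial_def)
qed

lemma cesaro_binomial_Suc:
  assumes "\<alpha> > -1"
  shows "cesaro_binomial \<alpha> (Suc n) = cesaro_binomial \<alpha> n * ((real n + 1 + \<alpha>) / (real n + 1))"
proof -
  have "Gamma (real n + \<alpha> + 1 + 1) = (real n + \<alpha> + 1) * Gamma (real n + \<alpha> + 1)"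
    using assms by (intro Gamma_plus1) (auto dest!: nonpos_Ints_nonpos)
  moreover have "Gamma (real n + 1 + 1) = (real n + 1) * Gamma (real n + 1)"
    by (intro Gamma_plus1) (auto dest!: nonpos_Ints_nonpos)
  ultimately show ?thesis
    by (simp add: cesaro_binomial_def add_ac mult_ac)
qed

lemma cesaro_binomial_pos: "\<alpha> > -1 \<Longrightarrow> cesaro_binomial \<alpha> n > 0"
  by (simp add: cesaro_binomial_def Gamma_real_pos)

text \<open>
  These numbers grow like \<open>sqrt n\<close>. In squared form the two-sided bound is stable under the
  recursion: the squared ratio of consecutive terms, \<open>(1 + 1 / (2 m))\<^sup>2\<close>, lies between
  \<open>(m + 1) / m\<close> and \<open>(2 m + 1) / (2 m - 1)\<close>.
\<close>

lemma cesaro_binomial_half_square_bounds: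
  "real n + 1 \<le> (cesaro_binomial (1/2) n)\<^sup>2" "(cesaro_binomial (1/2) n)\<^sup>2 \<le> 2 * real n + 1"
proof (induction n)
  case 0
  case 1 show ?case by (simp add: cesaro_binomial_0)
  case 2 show ?case by (simp add: cesaro_binomial_0)
next
  case (Suc n)
  let ?r = "((real n + 3/2) / (real n + 1))\<^sup>2"
  have r: "(cesaro_binomial (1/2) (Suc n))\<^sup>2 = (cesaro_binomial (1/2) n)\<^sup>2 * ?r"
    by (simp add: cesaro_binomial_Suc power_mult_distrib power_divide add_ac)
  have "(real n + 1) * ?r = (real n + 3/2)\<^sup>2 / (real n + 1)"
    by (simp add: power2_eq_square)
  moreover have "real (Suc n) + 1 \<le> (real n + 3/2)\<^sup>2 / (real n + 1)"
    by (simp add: divide_simps power2_eq_square) (simp add: algebra_simps)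
  moreover have "(real n + 1) * ?r \<le> (cesaro_binomial (1/2) n)\<^sup>2 * ?r"
    by (intro mult_right_mono Suc.IH) simp
  ultimately show "real (Suc n) + 1 \<le> (cesaro_binomial (1/2) (Suc n))\<^sup>2" unfolding r by linarith
  have "(cesaro_binomial (1/2) n)\<^sup>2 * ?r \<le> (2 * real n + 1) * ?r"
    by (intro mult_right_mono Suc.IH) simp
  also have "\<dots> \<le> 2 * real (Suc n) + 1"
    by (simp add: divide_simps power2_eq_square) (simp add: algebra_simps)
  finally show "(cesaro_binomial (1/2) (Suc n))\<^sup>2 \<le> 2 * real (Suc n) + 1" unfolding r .
qed

text \<open>
  The factor by which the mean with index \<open>n\<close> multiplies the \<open>k\<close>-th Taylor coefficient. Its
  vanishing for \<open>k > n\<close> allows the mean to be treated as a full power series.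
\<close>

definition cesaro_weight :: "nat \<Rightarrow> nat \<Rightarrow> real" where
  "cesaro_weight n k = (if k \<le> n then cesaro_binomial (1/2) (n - k) / cesaro_binomial (1/2) n else 0)"

text \<open>
  With \<open>m = n - j\<close> and \<open>A\<close> the binomial numbers, the drop is \<open>(A\<^sub>m - A\<^sub>m\<^sub>-\<^sub>1) / A\<^sub>n\<close>. The
  increment of \<open>A\<close> at \<open>m\<close> is \<open>A\<^sub>m / (2 m + 1)\<close>, of order \<open>1 / sqrt (m + 1)\<close>. Order one half is
  special in that these increments just fail to be square summable.
\<close>

lemma cesaro_weight_drop:
  assumes "j \<le> n"
  shows "cesaro_weight n j - cesaro_weight n (Suc j) \<ge> 1 / (2 * sqrt (real (n - j) + 1) * sqrt (2 * real n + 1))"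
proof -
  define m where "m = n - j"
  define A where "A = cesaro_binomial (1/2)"
  have A: "A k > 0" for k by (simp add: A_def cesaro_binomial_pos)
  have An: "A n \<le> sqrt (2 * real n + 1)"
    using cesaro_binomial_half_square_bounds(2)[of n] by (simp add: A_def real_le_rsqrt)
  have diff: "cesaro_weight n j - cesaro_weight n (Suc j) = (A m - (if m = 0 then 0 else A (m - 1))) / A n"
    using assms by (auto simp: cesaro_weight_def m_def A_def diff_divide_distrib)
  have inc: "A m - (if m = 0 then 0 else A (m - 1)) \<ge> 1 / (2 * sqrt (real m + 1))"
  proof (cases m)
    case 0
    then show ?thesis by (simp add: A_def cesaro_binomial_0)
  next
    case (Suc p)
    have "A (Suc p) - A p = A (Suc p) / (2 * real p + 3)"
    proof -
      have r: "A (Suc p) = A p * (2 * real p + 3) / (2 * (real p + 1))"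
        by (simp add: A_def cesaro_binomial_Suc field_simps)
      have "A (Suc p) - A p = A p / (2 * (real p + 1))"
        unfolding r by (simp add: field_simps)
      moreover have "2 * real p + 3 \<noteq> 0" by linarith
      ultimately show ?thesis by (simp add: r)
    qed
    moreover have "sqrt (real m + 1) \<le> A (Suc p)"
      using cesaro_binomial_half_square_bounds(1)[of m] A[of m] Suc by (simp add: A_def real_le_lsqrt)
    ultimately have "A (Suc p) - A p \<ge> sqrt (real m + 1) / (2 * real p + 3)"
      by (simp add: divide_right_mono)
    moreover have "sqrt (real m + 1) / (2 * real p + 3) \<ge> sqrt (real m + 1) / (2 * (real m + 1))"
      using Suc by (intro divide_left_mono) auto
    moreover have "sqrt (real m + 1) / (2 * (real m + 1)) = 1 / (2 * sqrt (real m + 1))"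
      using real_sqrt_mult_self[of "real m + 1"] by (simp add: field_simps)
    ultimately show ?thesis using Suc by simp
  qed
  have "1 / (2 * sqrt (real m + 1) * sqrt (2 * real n + 1)) = 1 / (2 * sqrt (real m + 1)) / sqrt (2 * real n + 1)"
    by simp
  also have "\<dots> \<le> (A m - (if m = 0 then 0 else A (m - 1))) / A n"
  proof (rule frac_le)
    have "0 \<le> 1 / (2 * sqrt (real m + 1))" by simp
    then show "0 \<le> A m - (if m = 0 then 0 else A (m - 1))" using inc by linarith
  qed (use inc An A in auto)
  finally show ?thesis by (simp add: diff m_def)
qed

lemma cesaro_weight_le_1:
  assumes "j \<le> n" shows "cesaro_weight n j \<le> 1"
  using assms
proof (induction j)
  case 0
  then show ?case using cesaro_binomial_pos[of "1/2" n] by (simp add: cesaro_weight_def)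
next
  case (Suc j)
  have "0 \<le> 1 / (2 * sqrt (real (n - j) + 1) * sqrt (2 * real n + 1))" by simp
  also have "\<dots> \<le> cesaro_weight n j - cesaro_weight n (Suc j)"
    using Suc by (intro cesaro_weight_drop) simp
  finally show ?case using Suc by simp
qed

lemma summation_by_parts_tail:
  fixes b c :: "nat \<Rightarrow> real"
  assumes "k \<le> n" and "c (Suc n) = 0"
  shows "(\<Sum>j\<in>{k<..n}. c j * (b (j - 1) - b j)) =
    c (Suc k) * b k - (\<Sum>j\<in>{k<..n}. (c j - c (Suc j)) * b j)"
  using assms(1)
proof (induction k rule: inc_induct)
  case base
  then show ?case using assms(2) by simp
next
  case (step k)
  have "{k<..n} = insert (Suc k) {Suc k<..n}" using step by auto
  then show ?case using step.IH by (simp add: algebra_simps)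
qed

lemma cesaro_mean_power_series:
  assumes f: "\<And>z. cmod z < 1 \<Longrightarrow> (\<lambda>k. a k * z ^ k) sums f z"
  shows "cesaro_mean (1/2) n f z = (\<Sum>k\<le>n. of_real (cesaro_weight n k) * a k * z ^ k)"
proof -
  have "f has_fps_expansion Abs_fps a"
  proof (rule has_fps_expansionI)
    have "\<forall>\<^sub>F u in nhds (0::complex). u \<in> unit_disk"
      by (rule eventually_nhds_in_open) auto
    then show "\<forall>\<^sub>F u in nhds 0. (\<lambda>n. fps_nth (Abs_fps a) n * u ^ n) sums f u"
      by (rule eventually_mono) (use f in auto)
  qed
  then have coeff: "fps_nth (fps_expansion f 0) k = a k" for k
    using fps_nth_fps_expansion[of f "Abs_fps a" k] by (simp add: fps_expansion_def)
  show ?thesis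
    unfolding cesaro_mean_def coeff sum_distrib_left atLeast0AtMost
  proof (rule sum.cong)
    fix k assume "k \<in> {..n}"
    then have "complex_of_real (cesaro_weight n k) =
        inverse (of_real (cesaro_binomial (1/2) n)) * of_real (cesaro_binomial (1/2) (n - k))"
      by (simp add: cesaro_weight_def) (simp only: divide_inverse mult.commute)
    then show "inverse (of_real (cesaro_binomial (1/2) n)) *
        (of_real (cesaro_binomial (1/2) (n - k)) * a k * z ^ k) = of_real (cesaro_weight n k) * a k * z ^ k"
      by (simp only: mult.assoc)
  qed simp
qed

section \<open>Divergence\<close>

text \<open>
  By the \<open>l\<^sup>2\<close> formula, the squared norm of the error is \<open>\<Sum> (g k)\<^sup>2\<close> for the sequence \<open>g\<close>
  belonging to the error in place of \<open>f\<close>. Summation by parts writes \<open>g k\<close> as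
  \<open>(c (k + 1) - 1) * b k\<close> minus the sum of the drops of \<open>c\<close> times the entries of \<open>b\<close> beyond
  \<open>k\<close>. For nonnegative \<open>b\<close> both parts are nonpositive, so they cannot cancel, and the second one
  alone bounds \<open>\<bar>g k\<bar>\<close> from below.
\<close>

lemma cesaro_error_lower_bound:
  fixes b :: "nat \<Rightarrow> real" and f :: "complex \<Rightarrow> complex"
  assumes f: "\<And>z. cmod z < 1 \<Longrightarrow> (\<lambda>k. of_real (a k) * z ^ k) sums f z"
    and a: "\<And>k. a (Suc k) = b k - b (Suc k)"
    and b: "\<And>k. b k \<ge> 0" "summable (\<lambda>k. (b k)\<^sup>2)"
  shows "(\<Sum>k<n. (\<Sum>j\<in>{k<..n}. b j / (2 * sqrt (real (n - j) + 1) * sqrt (2 * real n + 1)))\<^sup>2)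
    \<le> (dirichlet_norm omega1 (\<lambda>z. cesaro_mean (1/2) n f z - f z))\<^sup>2"
proof -
  define c where "c = cesaro_weight n"
  define h where "h z = cesaro_mean (1/2) n f z - f z" for z
  define g where "g k = (\<Sum>j\<in>{k<..n}. c j * a j) - b k" for k
  define X where "X k = (\<Sum>j\<in>{k<..n}. b j / (2 * sqrt (real (n - j) + 1) * sqrt (2 * real n + 1)))" for k
  have c0: "c k = 0" if "k > n" for k using that by (simp add: c_def cesaro_weight_def)
  have h: "(\<lambda>k. of_real ((c k - 1) * a k) * z ^ k) sums h z" if z: "cmod z < 1" for z
  proof -
    have "(\<lambda>k. of_real (c k) * of_real (a k) * z ^ k) sums (\<Sum>k\<le>n. of_real (c k) * of_real (a k) * z ^ k)"
      by (rule sums_finite) (auto simp: c0)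
    then have "(\<lambda>k. of_real (c k) * of_real (a k) * z ^ k) sums cesaro_mean (1/2) n f z"
      by (subst cesaro_mean_power_series[where a="\<lambda>k. of_real (a k)", OF f]) (auto simp: c_def)
    from sums_diff[OF this f[OF z]] show ?thesis by (simp add: h_def algebra_simps)
  qed
  have g_step: "(c (Suc k) - 1) * a (Suc k) = g k - g (Suc k)" for k
  proof (cases "k < n")
    case True
    then have "{k<..n} = insert (Suc k) {Suc k<..n}" by auto
    then show ?thesis by (simp add: g_def a algebra_simps)
  next
    case False
    then show ?thesis by (simp add: g_def a c0)
  qed
  have g_le: "g k \<le> - X k" if "k < n" for k
  proof -
    have "(\<Sum>j\<in>{k<..n}. c j * a j) = (\<Sum>j\<in>{k<..n}. c j * (b (j - 1) - b j))"
    proof (rule sum.cong)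
      fix j assume "j \<in> {k<..n}"
      then show "c j * a j = c j * (b (j - 1) - b j)" by (cases j) (auto simp: a)
    qed simp
    also have "\<dots> = c (Suc k) * b k - (\<Sum>j\<in>{k<..n}. (c j - c (Suc j)) * b j)"
      using that by (intro summation_by_parts_tail c0) auto
    also have "\<dots> \<le> b k - X k"
    proof (rule diff_mono)
      show "c (Suc k) * b k \<le> b k"
        using that b(1)[of k] mult_right_mono[OF cesaro_weight_le_1, of "Suc k" n "b k"] by (simp add: c_def)
      show "X k \<le> (\<Sum>j\<in>{k<..n}. (c j - c (Suc j)) * b j)"
        unfolding X_def
      proof (rule sum_mono)
        fix j assume "j \<in> {k<..n}"
        then show "b j / (2 * sqrt (real (n - j) + 1) * sqrt (2 * real n + 1)) \<le> (c j - c (Suc j)) * b j"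
          using mult_right_mono[OF cesaro_weight_drop b(1), of j n j] by (simp add: c_def)
      qed
    qed
    finally show ?thesis by (simp add: g_def)
  qed
  have X0: "X k \<ge> 0" for k unfolding X_def by (intro sum_nonneg divide_nonneg_nonneg b) simp
  have g2: "summable (\<lambda>k. (g k)\<^sup>2)"
  proof -
    have "\<forall>\<^sub>F k in sequentially. (b k)\<^sup>2 = (g k)\<^sup>2"
      using eventually_ge_at_top[of n] by eventually_elim (simp add: g_def)
    then show ?thesis using b(2) summable_cong[of "\<lambda>k. (b k)\<^sup>2" "\<lambda>k. (g k)\<^sup>2"] by simp
  qed
  have "dirichlet_integral omega1 h = ennreal (\<Sum>k. (cmod (of_real (g k)))\<^sup>2)"
    using dirichlet_integral_omega1_power_series[of "\<lambda>k. of_real ((c k - 1) * a k)" h "\<lambda>k. of_real (g k)"]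
      h g2 by (simp add: g_step del: of_real_mult)
  then have D: "dirichlet_integral omega1 h = ennreal (\<Sum>k. (g k)\<^sup>2)" by simp
  have "(\<Sum>k<n. (X k)\<^sup>2) \<le> (\<Sum>k<n. (g k)\<^sup>2)"
  proof (rule sum_mono)
    fix k assume "k \<in> {..<n}"
    then have "X k \<le> - g k" using g_le[of k] by simp
    then have "(X k)\<^sup>2 \<le> (- g k)\<^sup>2" using X0 by (intro power_mono) auto
    then show "(X k)\<^sup>2 \<le> (g k)\<^sup>2" by simp
  qed
  also have "\<dots> \<le> (\<Sum>k. (g k)\<^sup>2)" by (intro sum_le_suminf g2) auto
  also have "\<dots> \<le> (dirichlet_norm omega1 h)\<^sup>2"
    by (simp add: dirichlet_norm_def D suminf_nonneg g2)
  finally show ?thesis unfolding X_def h_def .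
qed

text \<open>
  On the block \<open>l < j \<le> 2 l\<close> consider the entries \<open>1 / (H * sqrt (2 l - j + 1))\<close>, with \<open>H\<close> the
  \<open>l\<close>-th harmonic number. Their squares add up to \<open>1 / H\<close>. At the index \<open>n = 2 l\<close>, however, the
  weights of the inner sum are proportional to the same inverse square roots, so for each of
  the \<open>l\<close> values \<open>k < l\<close> the inner sum has size about \<open>1 / sqrt n\<close>, and the outer sum stays
  away from \<open>0\<close>. Choosing the \<open>i\<close>-th block with \<open>H \<ge> 2 ^ i\<close> and adding the squares of all
  blocks keeps the sequence square summable.
\<close>

lemma exists_resonant_sequence:
  obtains b :: "nat \<Rightarrow> real" and l :: "nat \<Rightarrow> nat"
  where "\<And>k. b k \<ge> 0" and "summable (\<lambda>k. (b k)\<^sup>2)" and "\<And>i. l i \<ge> i"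
    and "\<And>i. 1 / 20 \<le> (\<Sum>k<2 * l i. (\<Sum>j\<in>{k<..2 * l i}.
      b j / (2 * sqrt (real (2 * l i - j) + 1) * sqrt (2 * real (2 * l i) + 1)))\<^sup>2)"
proof -
  have "\<exists>l. l \<ge> i \<and> 2 ^ i \<le> (harm l :: real)" for i :: nat
  proof -
    have "\<forall>\<^sub>F l in sequentially. l \<ge> i \<and> 2 ^ i \<le> (harm l :: real)"
      using harm_at_top unfolding filterlim_at_top
      by (intro eventually_conj eventually_ge_at_top) auto
    then show ?thesis by (auto simp: eventually_sequentially)
  qed
  then obtain l where l: "\<And>i. l i \<ge> i" "\<And>i. 2 ^ i \<le> (harm (l i) :: real)" by metis
  define H where "H i = (harm (l i) :: real)" for i
  have H: "H i \<ge> 2 ^ i" "H i > 0" for i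
    using l(2)[of i] less_le_trans[of 0 "2 ^ i" "H i"] by (simp_all only: H_def) simp
  have lpos: "l i > 0" for i using H(2)[of i] by (simp add: H_def)
  have harm_sum: "(\<Sum>j\<in>{l i<..2 * l i}. 1 / (real (2 * l i - j) + 1)) = H i" for i
  proof -
    have "(\<Sum>j\<in>{l i<..2 * l i}. 1 / (real (2 * l i - j) + 1)) = (\<Sum>m<l i. 1 / (real m + 1))"
      by (rule sum.reindex_bij_witness[of _ "\<lambda>m. 2 * l i - m" "\<lambda>j. 2 * l i - j"]) auto
    then show ?thesis by (simp add: H_def harm_altdef inverse_eq_divide add.commute)
  qed
  define u where "u i j = (if l i < j \<and> j \<le> 2 * l i then 1 / ((H i)\<^sup>2 * (real (2 * l i - j) + 1)) else 0)" for i j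
  \<comment> \<open>The block with index \<open>i\<close> lies beyond \<open>l i \<ge> i\<close>, so restricting to \<open>i < j\<close> loses nothing and
    makes the sum finite.\<close>
  define b where "b j = sqrt (\<Sum>i<j. u i j)" for j
  have u0: "u i j \<ge> 0" for i j by (simp add: u_def)
  have b2: "(b j)\<^sup>2 = (\<Sum>i<j. u i j)" for j by (simp add: b_def sum_nonneg u0)
  have row: "(\<Sum>j<J. u i j) \<le> (1/2) ^ i" for i J
  proof -
    have "(\<Sum>j<J. u i j) = (\<Sum>j\<in>{..<J} \<inter> {l i<..2 * l i}. u i j)"
      by (rule sum.mono_neutral_right) (auto simp: u_def)
    also have "\<dots> \<le> (\<Sum>j\<in>{l i<..2 * l i}. u i j)"
      by (rule sum_mono2) (auto simp: u0)
    also have "\<dots> = (\<Sum>j\<in>{l i<..2 * l i}. (1 / (H i)\<^sup>2) * (1 / (real (2 * l i - j) + 1)))"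
      by (intro sum.cong) (simp_all add: u_def)
    also have "\<dots> = 1 / H i"
      unfolding sum_distrib_left[symmetric] harm_sum by (simp add: power2_eq_square)
    also have "\<dots> \<le> 1 / 2 ^ i" using H[of i] by (intro divide_left_mono) auto
    finally show ?thesis by (simp add: power_one_over)
  qed
  have b_square_summable: "summable (\<lambda>k. (b k)\<^sup>2)"
  proof (rule summableI_nonneg_bounded)
    fix J
    have "(\<Sum>j<J. (b j)\<^sup>2) \<le> (\<Sum>j<J. \<Sum>i<J. u i j)"
      unfolding b2 by (intro sum_mono sum_mono2) (auto simp: u0)
    also have "\<dots> = (\<Sum>i<J. \<Sum>j<J. u i j)" by (rule sum.swap)
    also have "\<dots> \<le> (\<Sum>i<J. (1/2) ^ i)" by (intro sum_mono row)
    also have "\<dots> \<le> (\<Sum>i. (1/2) ^ i)" by (intro sum_le_suminf summable_geometric) auto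
    finally show "(\<Sum>j<J. (b j)\<^sup>2) \<le> (\<Sum>i. (1/2) ^ i)" .
  qed simp
  have b_nonneg: "b k \<ge> 0" for k by (simp add: b_def sum_nonneg u0)
  have b_resonates: "1 / 20 \<le> (\<Sum>k<2 * l i. (\<Sum>j\<in>{k<..2 * l i}.
      b j / (2 * sqrt (real (2 * l i - j) + 1) * sqrt (2 * real (2 * l i) + 1)))\<^sup>2)" for i
  proof -
    define n where "n = 2 * l i"
    define w where "w j = b j / (2 * sqrt (real (n - j) + 1) * sqrt (2 * real n + 1))" for j
    have w0: "w j \<ge> 0" for j unfolding w_def by (simp add: b_def sum_nonneg u0)
    have w_ge: "w j \<ge> (1 / (2 * H i * sqrt (2 * real n + 1))) * (1 / (real (n - j) + 1))"
      if j: "j \<in> {l i<..n}" for j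
    proof -
      have "u i j \<le> (\<Sum>i<j. u i j)"
        using j l(1)[of i] by (intro member_le_sum) (auto simp: u0)
      then have "sqrt (u i j) \<le> b j" by (simp add: b_def)
      moreover have "sqrt (u i j) = 1 / (H i * sqrt (real (n - j) + 1))"
        using j H(2)[of i] by (simp add: u_def n_def real_sqrt_divide real_sqrt_mult)
      ultimately have "1 / (H i * sqrt (real (n - j) + 1)) / (2 * sqrt (real (n - j) + 1) * sqrt (2 * real n + 1)) \<le> w j"
        unfolding w_def by (intro divide_right_mono) auto
      moreover have "1 / (H i * sqrt (real (n - j) + 1)) / (2 * sqrt (real (n - j) + 1) * sqrt (2 * real n + 1))
        = (1 / (2 * H i * sqrt (2 * real n + 1))) * (1 / (sqrt (real (n - j) + 1) * sqrt (real (n - j) + 1)))"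
        by (simp add: mult_ac)
      moreover have "sqrt (real (n - j) + 1) * sqrt (real (n - j) + 1) = real (n - j) + 1" by simp
      ultimately show ?thesis by (simp only:)
    qed
    have inner: "(\<Sum>j\<in>{k<..n}. w j) \<ge> 1 / (2 * sqrt (2 * real n + 1))" if "k < l i" for k
    proof -
      have "1 / (2 * sqrt (2 * real n + 1)) = (1 / (2 * H i * sqrt (2 * real n + 1))) * H i"
      proof -
        have "H i \<noteq> 0" using H(2)[of i] by simp
        then show ?thesis by simp
      qed
      also have "\<dots> = (\<Sum>j\<in>{l i<..n}. (1 / (2 * H i * sqrt (2 * real n + 1))) * (1 / (real (n - j) + 1)))"
        unfolding sum_distrib_left[symmetric] n_def harm_sum ..
      also have "\<dots> \<le> (\<Sum>j\<in>{l i<..n}. w j)" by (intro sum_mono w_ge)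
      also have "\<dots> \<le> (\<Sum>j\<in>{k<..n}. w j)" using that by (intro sum_mono2) (auto simp: w0)
      finally show ?thesis .
    qed
    have "1 / 20 \<le> real (l i) * (1 / (2 * sqrt (2 * real n + 1)))\<^sup>2"
    proof -
      have "(1 / (2 * sqrt (2 * real n + 1)))\<^sup>2 = 1 / (4 * (2 * real n + 1))"
        by (simp add: power_divide power_mult_distrib)
      moreover have "1 / 20 \<le> real (l i) / (4 * (2 * real n + 1))"
        using lpos[of i] by (simp add: n_def le_divide_eq)
      ultimately show ?thesis by simp
    qed
    also have "\<dots> = (\<Sum>k<l i. (1 / (2 * sqrt (2 * real n + 1)))\<^sup>2)" by simp
    also have "\<dots> \<le> (\<Sum>k<l i. (\<Sum>j\<in>{k<..n}. w j)\<^sup>2)"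
      by (intro sum_mono power_mono inner) auto
    also have "\<dots> \<le> (\<Sum>k<n. (\<Sum>j\<in>{k<..n}. w j)\<^sup>2)"
      by (intro sum_mono2) (auto simp: n_def)
    finally show ?thesis by (simp only: n_def w_def)
  qed
  show ?thesis by (rule that[OF b_nonneg b_square_summable l(1) b_resonates])
qed

theorem theorem1p2:
  shows "\<exists>f \<in> dirichlet_space omega1.
    \<not> (\<lambda>n. dirichlet_norm omega1 (\<lambda>z. cesaro_mean (1/2) n f z - f z)) \<longlonglongrightarrow> 0"
proof -
  obtain b :: "nat \<Rightarrow> real" and l :: "nat \<Rightarrow> nat" where
    b: "\<And>k. b k \<ge> 0" "summable (\<lambda>k. (b k)\<^sup>2)" and l: "\<And>i. l i \<ge> i" and
    large: "\<And>i. 1 / 20 \<le> (\<Sum>k<2 * l i. (\<Sum>j\<in>{k<..2 * l i}.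
      b j / (2 * sqrt (real (2 * l i - j) + 1) * sqrt (2 * real (2 * l i) + 1)))\<^sup>2)"
    by (rule exists_resonant_sequence) (rule that; assumption)
  \<comment> \<open>Any constant term gives the same error, since \<open>cesaro_mean\<close> reproduces constants.\<close>
  define a where "a k = (case k of 0 \<Rightarrow> 0 | Suc k \<Rightarrow> b k - b (Suc k))" for k
  define f where "f z = (\<Sum>k. complex_of_real (a k) * z ^ k)" for z
  have a: "a (Suc k) = b k - b (Suc k)" for k by (simp add: a_def)
  have "Bseq b"
  proof -
    have "(\<lambda>k. sqrt ((b k)\<^sup>2)) \<longlonglongrightarrow> sqrt 0"
      by (intro tendsto_real_sqrt summable_LIMSEQ_zero b)
    then have "b \<longlonglongrightarrow> 0" using b(1) by simp
    then show ?thesis by (intro convergent_imp_Bseq convergentI)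
  qed
  then obtain K where K: "\<And>k. \<bar>b k\<bar> \<le> K" by (auto simp: Bseq_def)
  have a_bound: "\<bar>a k\<bar> \<le> 2 * K" for k
    using K[of 0] K[of k] K[of "k - 1"] by (auto simp: a_def split: nat.split)
  have f: "(\<lambda>k. of_real (a k) * z ^ k) sums f z" if "cmod z < 1" for z
  proof -
    have "summable (\<lambda>k. of_real (a k) * z ^ k)"
    proof (rule summable_comparison_test')
      show "summable (\<lambda>k. 2 * K * cmod z ^ k)"
        using that by (intro summable_mult summable_geometric) simp
      show "norm (of_real (a k) * z ^ k) \<le> 2 * K * cmod z ^ k" for k
        using a_bound[of k] by (simp add: norm_mult norm_power mult_right_mono)
    qed
    then show ?thesis unfolding f_def by (rule summable_sums)
  qed
  have "f holomorphic_on unit_disk"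
  proof (rule holomorphic_onI)
    fix z :: complex assume "z \<in> unit_disk"
    then have "(f has_field_derivative (\<Sum>k. diffs (\<lambda>k. of_real (a k)) k * z ^ k)) (at z)"
      by (intro has_field_derivative_power_series[OF f]) auto
    then show "f field_differentiable at z within unit_disk"
      by (meson field_differentiable_at_within field_differentiable_def)
  qed
  moreover have "dirichlet_integral omega1 f = ennreal (\<Sum>k. (cmod (of_real (b k)))\<^sup>2)"
    by (rule dirichlet_integral_omega1_power_series[OF f]) (simp_all add: a b)
  ultimately have "f \<in> dirichlet_space omega1" by (simp add: dirichlet_space_def)
  moreover have "\<not> (\<lambda>n. dirichlet_norm omega1 (\<lambda>z. cesaro_mean (1/2) n f z - f z)) \<longlonglongrightarrow> 0"
  proof
    assume "(\<lambda>n. dirichlet_norm omega1 (\<lambda>z. cesaro_mean (1/2) n f z - f z)) \<longlonglongrightarrow> 0"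
    then have "(\<lambda>n. (dirichlet_norm omega1 (\<lambda>z. cesaro_mean (1/2) n f z - f z))\<^sup>2) \<longlonglongrightarrow> 0\<^sup>2"
      by (rule tendsto_power)
    then have "\<forall>\<^sub>F n in sequentially. (dirichlet_norm omega1 (\<lambda>z. cesaro_mean (1/2) n f z - f z))\<^sup>2 < 1 / 20"
      by (rule order_tendstoD) simp
    then obtain N where N: "\<And>n. n \<ge> N \<Longrightarrow> (dirichlet_norm omega1 (\<lambda>z. cesaro_mean (1/2) n f z - f z))\<^sup>2 < 1 / 20"
      by (auto simp: eventually_sequentially)
    have "1 / 20 \<le> (dirichlet_norm omega1 (\<lambda>z. cesaro_mean (1/2) (2 * l N) f z - f z))\<^sup>2"
      using large[of N] cesaro_error_lower_bound[OF f a b, of "2 * l N"] by linarith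
    moreover have "2 * l N \<ge> N" using l[of N] by simp
    ultimately show False using N[of "2 * l N"] by simp
  qed
  ultimately show ?thesis by blast
qed

end
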